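(* Let $X$ be a nonempty set and let $P,Q$ be predicates on $X$. Then $$\mathfrak{UM}(\neg P)=\{f\in\mathcal P(X)^X\mid\exists g\in\mathfrak{UM}(P):\ f(x)=X\setminus g(x)\ \ \forall x\in X\},$$ $$\mathfrak{UM}(P\,\&\,Q)=\{f\in\mathcal P(X)^X\mid\exists g\in\mathfrak{UM}(P)\ \exists q\in\mathfrak{UM}(Q):\ f(x)=g(x)\cap q(x)\ \ \forall x\in X\},$$ $$\mathfrak{UM}(P\lor Q)=\{f\in\mathcal P(X)^X\mid\exists g\in\mathfrak{UM}(P)\ \exists q\in\mathfrak{UM}(Q):\ f(x)=g(x)\cup q(x)\ \ \forall x\in X\}.$$
   Context: $\mathcal P(X)^X$ is the set of all multifunctions $f:X\to\mathcal P(X)$, where $\mathcal P(X)$ is the power set of $X$. A predicate on $X$ is a function $P:X\to\{0,1\}$ with truth set $P^{-1}(1)$; $\neg P$, $P\,\&\,Q$, $P\lor Q$ are the pointwise logical negation, conjunction and disjunction. For $f\in\mathcal P(X)^X$, $\mathbf{Fix}(f)=\{x\in X\mid x\in f(x)\}$, and $\mathfrak{UM}(P)=\{f\in\mathcal P(X)^X\mid\mathbf{Fix}(f)=P^{-1}(1)\}$. *)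

theory Defs
  imports Main "HOL-Library.FuncSet"
begin

text \<open>
  The set \<open>X\<close> is a carrier set. Multifunctions are extensional functions from \<open>X\<close> to its power
  set, so that two of them are equal iff they agree on \<open>X\<close>. A predicate on \<open>X\<close> is given by a
  function \<open>'a \<Rightarrow> bool\<close>, of which only the values on \<open>X\<close> matter (see \<open>truth_set\<close>).
\<close>

definition multifunctions :: "'a set \<Rightarrow> ('a \<Rightarrow> 'a set) set" where
  "multifunctions X = (X \<rightarrow>\<^sub>E Pow X)"

definition truth_set :: "'a set \<Rightarrow> ('a \<Rightarrow> bool) \<Rightarrow> 'a set" where
  "truth_set X P = {x \<in> X. P x}"

definition Fix :: "'a set \<Rightarrow> ('a \<Rightarrow> 'a set) \<Rightarrow> 'a set" where
  "Fix X f = {x \<in> X. x \<in> f x}"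

definition UM :: "'a set \<Rightarrow> ('a \<Rightarrow> bool) \<Rightarrow> ('a \<Rightarrow> 'a set) set" where
  "UM X P = {f \<in> multifunctions X. Fix X f = truth_set X P}"

end

theory Submission imports Defs begin

text \<open>
  Membership in \<open>UM X P\<close> is a pointwise condition: whether \<open>x \<in> f x\<close> is decided by \<open>P x\<close>.
  Complement, intersection and union of values act on the truth value of \<open>x \<in> f x\<close> as negation,
  conjunction and disjunction, so each right-hand side lies in the left-hand side.

  For the converse, \<open>f\<close> has to be decomposed. Complementation is an involution, so the pointwise
  complement of \<open>f\<close> settles the first equation. For the other two, toggling only the point \<open>x\<close>
  in the value \<open>f x\<close> yields members \<open>g\<close> of \<open>UM X P\<close> and \<open>q\<close> of \<open>UM X Q\<close> that agree with \<open>f\<close>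
  off the diagonal (\<open>adjust_fix_in_UM\<close>). Off the diagonal, \<open>g x \<inter> q x\<close> and \<open>g x \<union> q x\<close>
  therefore agree with \<open>f x\<close> by idempotence; on the diagonal they agree with it because \<open>f\<close> has the
  prescribed fixed points.
\<close>

lemma UM_iff:
  "f \<in> UM X P \<longleftrightarrow> f \<in> multifunctions X \<and> (\<forall>x\<in>X. x \<in> f x \<longleftrightarrow> P x)"
  by (auto simp: UM_def Fix_def truth_set_def)

definition adjust_fix :: "'a set \<Rightarrow> ('a \<Rightarrow> bool) \<Rightarrow> ('a \<Rightarrow> 'a set) \<Rightarrow> 'a \<Rightarrow> 'a set" where
  "adjust_fix X P f = (\<lambda>x\<in>X. if P x then insert x (f x) else f x - {x})"

lemma adjust_fix_in_UM:
  assumes "f \<in> multifunctions X"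
  shows "adjust_fix X P f \<in> UM X P"
  using assms by (auto simp: UM_iff multifunctions_def adjust_fix_def PiE_iff)

lemma UM_not:
  "UM X (\<lambda>x. \<not> P x) = {f \<in> multifunctions X. \<exists>g \<in> UM X P. \<forall>x \<in> X. f x = X - g x}"
    (is "?L = ?R")
proof
  show "?L \<subseteq> ?R"
  proof
    fix f assume f: "f \<in> ?L"
    define g where "g = (\<lambda>x\<in>X. X - f x)"
    have "g \<in> UM X P"
      using f by (auto simp: UM_iff multifunctions_def g_def)
    moreover have "\<forall>x\<in>X. f x = X - g x"
      using f by (auto simp: UM_iff multifunctions_def g_def)
    ultimately show "f \<in> ?R"
      using f by (auto simp: UM_iff)
  qed
qed (auto simp: UM_iff)

lemma UM_conj:
  "UM X (\<lambda>x. P x \<and> Q x) =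
     {f \<in> multifunctions X. \<exists>g \<in> UM X P. \<exists>q \<in> UM X Q. \<forall>x \<in> X. f x = g x \<inter> q x}"
    (is "?L = ?R")
proof
  show "?L \<subseteq> ?R"
  proof
    fix f assume f: "f \<in> ?L"
    then have mf: "f \<in> multifunctions X"
      by (simp add: UM_iff)
    have "\<forall>x\<in>X. f x = adjust_fix X P f x \<inter> adjust_fix X Q f x"
      using f by (auto simp: UM_iff adjust_fix_def)
    then show "f \<in> ?R"
      using mf adjust_fix_in_UM[OF mf] by blast
  qed
qed (auto simp: UM_iff)

lemma UM_disj:
  "UM X (\<lambda>x. P x \<or> Q x) =
     {f \<in> multifunctions X. \<exists>g \<in> UM X P. \<exists>q \<in> UM X Q. \<forall>x \<in> X. f x = g x \<union> q x}"
    (is "?L = ?R")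
proof
  show "?L \<subseteq> ?R"
  proof
    fix f assume f: "f \<in> ?L"
    then have mf: "f \<in> multifunctions X"
      by (simp add: UM_iff)
    have "\<forall>x\<in>X. f x = adjust_fix X P f x \<union> adjust_fix X Q f x"
      using f by (auto simp: UM_iff adjust_fix_def)
    then show "f \<in> ?R"
      using mf adjust_fix_in_UM[OF mf] by blast
  qed
qed (auto simp: UM_iff)

theorem lemma3p3:
  fixes X :: "'a set" and P Q :: "'a \<Rightarrow> bool"
  assumes "X \<noteq> {}"
  shows "UM X (\<lambda>x. \<not> P x) =
           {f \<in> multifunctions X. \<exists>g \<in> UM X P. \<forall>x \<in> X. f x = X - g x}
       \<and> UM X (\<lambda>x. P x \<and> Q x) =
           {f \<in> multifunctions X. \<exists>g \<in> UM X P. \<exists>q \<in> UM X Q. \<forall>x \<in> X. f x = g x \<inter> q x}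
       \<and> UM X (\<lambda>x. P x \<or> Q x) =
           {f \<in> multifunctions X. \<exists>g \<in> UM X P. \<exists>q \<in> UM X Q. \<forall>x \<in> X. f x = g x \<union> q x}"
  by (intro conjI UM_not UM_conj UM_disj)

end
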